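(* Let $p,n$ be positive integers with $p\ge n\ge 6$ and $p=k(n-1)+1$ with $k$ a positive integer. Then $$ex(p;T_n^* )=\frac{(n-2)(p-1)}{2}.$$
   Context: All graphs are finite simple graphs. For $n\ge 4$, $T_n^*$ denotes the tree on the $n$ vertices $v_0,v_1,\ldots,v_{n-1}$ with edge set $\{v_0v_1,\ldots,v_0v_{n-3},\,v_{n-3}v_{n-2},\,v_{n-2}v_{n-1}\}$. For a graph $L$, $ex(p;L)$ denotes the maximal number of edges in a graph on $p$ vertices that does not contain $L$ as a (not necessarily induced) subgraph. *)

theory Defs
  imports Complex_Main "HOL-Library.Ramsey"
begin

text \<open>
  A graph is a pair of a vertex set and an edge set; the edges of a finite simple graph are
  two-element sets of vertices.
\<close>

type_synonym 'a graph = "'a set \<times> 'a set set"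

definition verts :: "'a graph \<Rightarrow> 'a set" where
  "verts G = fst G"

definition edges :: "'a graph \<Rightarrow> 'a set set" where
  "edges G = snd G"

definition simple_graph :: "'a graph \<Rightarrow> bool" where
  "simple_graph G \<longleftrightarrow> finite (verts G) \<and> edges G \<subseteq> nsets (verts G) 2"

text \<open>
  Containment as a not necessarily induced subgraph, up to isomorphism: non-edges of \<open>L\<close> may be
  mapped to edges of \<open>G\<close>.
\<close>

definition contains_subgraph :: "'b graph \<Rightarrow> 'a graph \<Rightarrow> bool" where
  "contains_subgraph G L \<longleftrightarrow>
     (\<exists>f. inj_on f (verts L) \<and> f ` verts L \<subseteq> verts G \<and> (\<forall>e\<in>edges L. f ` e \<in> edges G))"

text \<open>
  Host graphs have natural numbers as vertices; every finite graph is isomorphic to one of these.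
  The set of edge numbers is finite, and it is nonempty (so that \<open>Max\<close> is meaningful) whenever
  \<open>L\<close> has an edge.
\<close>

definition ex_number :: "nat \<Rightarrow> 'a graph \<Rightarrow> nat" where
  "ex_number p L =
     Max {card (edges G) | G :: nat graph.
            simple_graph G \<and> card (verts G) = p \<and> \<not> contains_subgraph G L}"

text \<open>The tree \<open>T\<^sub>n\<^sup>*\<close> for \<open>n \<ge> 4\<close>, with the number \<open>i\<close> as the vertex \<open>v\<^sub>i\<close>.\<close>

definition T_star :: "nat \<Rightarrow> nat graph" where
  "T_star n =
     ({0..n - 1}, {{0, i} | i. 1 \<le> i \<and> i \<le> n - 3} \<union> {{n - 3, n - 2}, {n - 2, n - 1}})"

end

theory Submission
  imports Defs
begin

text \<open>
  Write \<open>N\<close> for the neighbourhood of a vertex \<open>v\<close> of degree \<open>d \<ge> n - 2\<close> in a graph without \<open>T\<^sub>n\<^sup>*\<close>.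
  A path \<open>v a b c\<close> leaves at least \<open>n - 4\<close> spare neighbours of \<open>v\<close>, and so gives a copy of
  \<open>T\<^sub>n\<^sup>*\<close>, unless \<open>d = n - 2\<close> and \<open>b, c \<in> N\<close>. Hence the ball of radius two about \<open>v\<close> is a union
  of components: the vertices at distance two are leaves, attached to vertices without
  neighbours in \<open>N\<close>. Such a ball \<open>C\<close> spans at most \<open>(n - 2) (\<bar>C\<bar> - 1) / 2\<close> edges, unless it is just
  \<open>N \<union> {v}\<close> with \<open>n - 1\<close> vertices. Splitting off balls leaves a graph of maximal degree at most
  \<open>n - 3\<close>. By induction, twice the number of edges is at most \<open>(n - 2) p\<close>, and at most
  \<open>(n - 2) (p - 1)\<close> if \<open>n - 1\<close> does not divide the order \<open>p\<close>. Disjoint copies of \<open>K\<^bsub>n-1\<^esub>\<close> together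
  with an isolated vertex attain the bound.
\<close>

section \<open>Counting edges through degrees\<close>

lemma double_choose_two: "2 * (m choose 2) = m * (m - 1)"
proof -
  have "even (m * (m - 1))"
    by (cases "even m") auto
  then show ?thesis
    by (simp add: choose_two)
qed

lemma handshake:
  assumes "finite V" "E \<subseteq> nsets V 2"
  shows "2 * card E = (\<Sum>u\<in>V. card {w\<in>V. {u, w} \<in> E})"
proof -
  have fE: "finite E"
    using assms finite_imp_finite_nsets finite_subset by blast
  have "card {w\<in>V. {u, w} \<in> E} = card {e\<in>E. u \<in> e}" if "u \<in> V" for u
  proof (rule bij_betw_same_card)
    have "e \<in> (\<lambda>w. {u, w}) ` {w \<in> V. {u, w} \<in> E}" if e: "e \<in> E" "u \<in> e" for e
    proof -
      from e assms obtain x y where "e = {x, y}" "x \<in> V" "y \<in> V"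
        by (auto simp: nsets_def card_2_iff)
      then show ?thesis
        using e by (auto simp: insert_commute)
    qed
    then show "bij_betw (\<lambda>w. {u, w}) {w\<in>V. {u, w} \<in> E} {e\<in>E. u \<in> e}"
      by (auto simp: bij_betw_def inj_on_def doubleton_eq_iff)
  qed
  then have "(\<Sum>u\<in>V. card {w\<in>V. {u, w} \<in> E}) = (\<Sum>u\<in>V. card {e\<in>E. u \<in> e})"
    by simp
  also have "\<dots> = (\<Sum>e\<in>E. card {u\<in>V. u \<in> e})"
    using sum_multicount_gen[OF assms(1) fE, of "\<lambda>u e. u \<in> e" "\<lambda>e. card {u\<in>V. u \<in> e}"] by simp
  also have "\<dots> = (\<Sum>e\<in>E. 2)"
  proof (rule sum.cong)
    fix e assume "e \<in> E"
    then have "{u\<in>V. u \<in> e} = e" "card e = 2"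
      using assms by (auto simp: nsets_def)
    then show "card {u\<in>V. u \<in> e} = 2"
      by simp
  qed simp
  finally show ?thesis
    by simp
qed

section \<open>Copies of the tree at a vertex of large degree\<close>

text \<open>The vertex \<open>v\<close> becomes the centre, \<open>a\<close>, \<open>b\<close>,
  \<open>c\<close> become the tail \<open>n - 3\<close>, \<open>n - 2\<close>, \<open>n - 1\<close>,
  and the \<open>n - 4\<close> elements of \<open>S\<close> become the remaining leaves
  \<open>1\<close>, ..., \<open>n - 4\<close>.\<close>

lemma contains_T_star:
  assumes sg: "simple_graph (V, E)" and n: "n \<ge> 5"
    and va: "{v, a} \<in> E" and ab: "{a, b} \<in> E" and bc: "{b, c} \<in> E"
    and "b \<noteq> v" "c \<noteq> v" "c \<noteq> a"
    and S: "S \<subseteq> {w. {v, w} \<in> E} - {a, b, c}" "card S = n - 4"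
  shows "contains_subgraph (V, E) (T_star n)"
proof -
  have E: "E \<subseteq> nsets V 2"
    using sg by (simp add: simple_graph_def edges_def verts_def)
  have edge: "x \<in> V \<and> y \<in> V \<and> x \<noteq> y" if "{x, y} \<in> E" for x y
    using that E by (auto simp: nsets_def card_2_iff doubleton_eq_iff)
  have "finite S"
    using S(2) n by (intro card_ge_0_finite) simp
  then obtain g where g: "bij_betw g {1..n - 4} S"
    using S(2) finite_same_card_bij[of "{1..n - 4}" S] by auto
  define f where "f i = (if i = 0 then v else if i \<le> n - 4 then g i
      else if i = n - 3 then a else if i = n - 2 then b else c)" for i
  have gS: "g i \<in> S" if "1 \<le> i" "i \<le> n - 4" for i
    using g that by (auto simp: bij_betw_def)
  have f0: "f 0 = v" and fa: "f (n - 3) = a" and fb: "f (n - 2) = b" and fc: "f (n - 1) = c"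
    using n by (auto simp: f_def)
  have fg: "f i = g i" if "1 \<le> i" "i \<le> n - 4" for i
    using that by (simp add: f_def)
  have V: "{0..n - 1} = insert 0 (insert (n - 3) (insert (n - 2) (insert (n - 1) {1..n - 4})))"
    using n by auto
  have vS: "v \<notin> S" "S \<subseteq> V"
    using S(1) edge by auto
  have im: "f ` {1..n - 4} = S"
    using g fg by (auto simp: bij_betw_def)
  have range: "f ` {0..n - 1} = insert v (insert a (insert b (insert c S)))"
    unfolding V image_insert im f0 fa fb fc ..
  have "a \<notin> S" "b \<notin> S" "c \<notin> S"
    using S(1) by auto
  \<comment> \<open>Injectivity by counting: \<open>v\<close>, \<open>a\<close>, \<open>b\<close>,
    \<open>c\<close> are distinct and outside \<open>S\<close>, so the image has
    \<open>4 + (n - 4) = n\<close> elements.\<close>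
  then have "card (f ` {0..n - 1}) = card {0..n - 1}"
    unfolding range using \<open>finite S\<close> S(2) vS(1) edge[OF va] edge[OF ab] edge[OF bc] assms(6-8) n
    by (simp add: card_insert_if)
  then have "inj_on f {0..n - 1}"
    by (intro eq_card_imp_inj_on) simp_all
  moreover have "f ` {0..n - 1} \<subseteq> V"
    unfolding range using vS(2) edge[OF va] edge[OF ab] edge[OF bc] by simp
  moreover have "f ` e \<in> E" if "e \<in> edges (T_star n)" for e
  proof -
    consider i where "1 \<le> i" "i \<le> n - 4" "e = {0, i}" | "e = {0, n - 3}"
      | "e = {n - 3, n - 2}" | "e = {n - 2, n - 1}"
    proof -
      have "i \<le> n - 4 \<or> i = n - 3" if "i \<le> n - 3" for i
        using that by auto
      then show thesis
        using that \<open>e \<in> edges (T_star n)\<close> by (auto simp: T_star_def edges_def)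
    qed
    then show ?thesis
    proof cases
      case 1
      then show ?thesis
        using gS[of i] fg[of i] f0 S(1) by auto
    qed (use f0 fa fb fc va ab bc in auto)
  qed
  ultimately show ?thesis
    unfolding contains_subgraph_def
    by (intro exI[of _ f]) (auto simp: verts_def edges_def T_star_def)
qed

text \<open>Without a copy of the tree, fewer than \<open>n - 4\<close> vertices of \<open>N\<close>
  avoid \<open>a\<close>, \<open>b\<close>, \<open>c\<close>. As \<open>N\<close> has at least
  \<open>n - 2\<close> elements, more than two of them must be among \<open>a\<close>,
  \<open>b\<close>, \<open>c\<close>; so all three lie in \<open>N\<close>, and
  \<open>card N - 3 < n - 4\<close> leaves only \<open>card N = n - 2\<close>.\<close>

lemma path_from_large_degree:
  assumes sg: "simple_graph (V, E)" and free: "\<not> contains_subgraph (V, E) (T_star n)" and n: "n \<ge> 6"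
    and N: "N = {w. {v, w} \<in> E}" and d: "card N \<ge> n - 2"
    and a: "a \<in> N" and ab: "{a, b} \<in> E" and bc: "{b, c} \<in> E"
    and ne: "b \<noteq> v" "c \<noteq> v" "c \<noteq> a"
  shows "b \<in> N \<and> c \<in> N \<and> card N = n - 2"
proof -
  have "finite N"
    using d n by (intro card_ge_0_finite) simp
  have less: "card (N - {a, b, c}) < n - 4"
  proof (rule ccontr)
    assume "\<not> ?thesis"
    then obtain S where "S \<subseteq> N - {a, b, c}" "card S = n - 4"
      by (meson not_less obtain_subset_with_card_n)
    then show False
      using contains_T_star[OF sg _ _ ab bc ne] n a free N by auto
  qed
  have diff: "card (N - {a, b, c}) = card N - card (N \<inter> {a, b, c})"
    by (simp add: card_Diff_subset_Int)
  have "card (N \<inter> {a, b, c}) \<le> card {a, b, c}"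
    by (intro card_mono) auto
  also have "\<dots> \<le> 3"
    by (simp add: card_insert_if)
  finally have "card (N \<inter> {a, b, c}) \<le> 3" .
  moreover have "card (N \<inter> {a, b, c}) \<le> 2" if "b \<notin> N \<or> c \<notin> N"
  proof -
    from that have "N \<inter> {a, b, c} \<subseteq> {a, b} \<or> N \<inter> {a, b, c} \<subseteq> {a, c}"
      by auto
    moreover have "card {a, b} \<le> 2" "card {a, c} \<le> 2"
      by (simp_all add: card_insert_if)
    ultimately show ?thesis
      by (meson card_mono finite.emptyI finite.insertI le_trans)
  qed
  ultimately show ?thesis
    using less diff d by linarith
qed

section \<open>Balls of radius two as unions of components\<close>

text \<open>No edge leaves \<open>C\<close> because the vertices of \<open>W\<close> are leaves. The
  edges in \<open>C\<close> are therefore those at \<open>v\<close>, those inside \<open>N\<close>,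
  and one for each vertex of \<open>W\<close>. The count weighs these against
  \<open>card C - 1 = d + r\<close>.\<close>

lemma ball_edges:
  assumes sg: "simple_graph (V, E)" and free: "\<not> contains_subgraph (V, E) (T_star n)" and n: "n \<ge> 6"
    and N: "N = {w. {v, w} \<in> E}" and d: "card N \<ge> n - 2"
    and W: "W = {w. \<exists>u\<in>N. {u, w} \<in> E} - insert v N"
    and C: "C = insert v (N \<union> W)"
  shows ball_closed: "e \<in> E \<Longrightarrow> e \<subseteq> C \<or> e \<inter> C = {}"
    and card_ball_edges: "card N \<noteq> n - 2 \<or> W \<noteq> {} \<Longrightarrow>
      2 * card (E \<inter> Pow C) + (n - 2) \<le> (n - 2) * card C"
proof -
  have E: "E \<subseteq> nsets V 2" and fV: "finite V"
    using sg by (auto simp: simple_graph_def edges_def verts_def)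
  have edge: "x \<in> V \<and> y \<in> V \<and> x \<noteq> y" if "{x, y} \<in> E" for x y
    using that E by (auto simp: nsets_def card_2_iff doubleton_eq_iff)
  have pair: "\<exists>x y. e = {x, y} \<and> x \<noteq> y" if "e \<in> E" for e
    using that E by (auto simp: nsets_def card_2_iff)
  have sym: "{y, x} \<in> E" if "{x, y} \<in> E" for x y
    using that by (simp add: insert_commute)
  note path = path_from_large_degree[OF sg free n N d]
  have fN: "finite N" and fW: "finite W"
    using fV edge N W by (auto intro: finite_subset)
  have vN: "v \<notin> N"
    using edge[of v v] N by auto
  \<comment> \<open>Otherwise \<open>v\<close>, \<open>a\<close>, \<open>w\<close>, \<open>x\<close>
    would be a path whose third vertex is outside \<open>N\<close>.\<close>
  have leaf: "x = a" if "w \<in> W" "a \<in> N" "{a, w} \<in> E" "{w, x} \<in> E" for w a x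
  proof -
    have "w \<noteq> v" "w \<notin> N" "x \<noteq> v"
      using that W N sym by auto
    then show ?thesis
      using path[OF that(2-4)] by auto
  qed
  \<comment> \<open>An edge from \<open>a\<close> to \<open>x\<close> would give the path
    \<open>v\<close>, \<open>x\<close>, \<open>a\<close>, \<open>w\<close>, which ends outside
    \<open>N\<close>.\<close>
  have indep: "{a, x} \<notin> E" if "a \<in> N" "w \<in> W" "{a, w} \<in> E" "x \<in> N" for a w x
  proof
    assume "{a, x} \<in> E"
    then have "{x, a} \<in> E"
      by (rule sym)
    then show False
      using path[of x a w] that vN W by auto
  qed
  have closed: "y \<in> C" if "{x, y} \<in> E" "x \<in> C" for x y
  proof -
    consider "x = v" | "x \<in> N" | "x \<in> W"
      using \<open>x \<in> C\<close> C by auto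
    then show ?thesis
    proof cases
      case 3
      then obtain a where "a \<in> N" "{a, x} \<in> E"
        using W by auto
      then show ?thesis
        using leaf 3 that C by auto
    qed (use that N W C in auto)
  qed
  show "e \<subseteq> C \<or> e \<inter> C = {}" if e: "e \<in> E"
  proof -
    obtain x y where "e = {x, y}"
      using pair e by blast
    then show ?thesis
      using closed[of x y] closed[of y x] e sym by auto
  qed
  assume big: "card N \<noteq> n - 2 \<or> W \<noteq> {}"
  define d r where "d = card N" and "r = card W"
  have "\<forall>w\<in>W. \<exists>a. a \<in> N \<and> {a, w} \<in> E"
    using W by auto
  \<comment> \<open>By \<open>leaf\<close>, \<open>h w\<close> is the only neighbour of
    \<open>w\<close>.\<close>
  then obtain h where h: "\<And>w. w \<in> W \<Longrightarrow> h w \<in> N \<and> {h w, w} \<in> E"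
    by metis
  have "E \<inter> Pow C \<subseteq> (\<lambda>u. {v, u}) ` N \<union> (E \<inter> Pow N) \<union> (\<lambda>w. {h w, w}) ` W"
  proof
    fix e assume e: "e \<in> E \<inter> Pow C"
    then obtain x y where xy: "e = {x, y}" "x \<noteq> y"
      using pair[of e] by auto
    consider "v \<in> e" | w where "w \<in> W" "w \<in> e" | "e \<subseteq> N"
      using e unfolding C by auto
    then show "e \<in> (\<lambda>u. {v, u}) ` N \<union> (E \<inter> Pow N) \<union> (\<lambda>w. {h w, w}) ` W"
    proof cases
      case 1
      then obtain u where "e = {v, u}"
        using xy by blast
      then show ?thesis
        using e N by auto
    next
      case 2
      then obtain x where x: "e = {w, x}"
        using xy by blast
      then have "x = h w"
        using leaf[OF \<open>w \<in> W\<close>, of "h w" x] h \<open>w \<in> W\<close> e by auto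
      then show ?thesis
        using x \<open>w \<in> W\<close> by (auto simp: insert_commute)
    qed (use e in auto)
  qed
  then have "card (E \<inter> Pow C) \<le>
      card ((\<lambda>u. {v, u}) ` N \<union> (E \<inter> Pow N) \<union> (\<lambda>w. {h w, w}) ` W)"
    using fN fW by (intro card_mono) auto
  also have "\<dots> \<le> card ((\<lambda>u. {v, u}) ` N) + card (E \<inter> Pow N) + card ((\<lambda>w. {h w, w}) ` W)"
    by (meson add_le_mono1 card_Un_le le_trans)
  also have "\<dots> \<le> d + card (E \<inter> Pow N) + r"
    unfolding d_def r_def using fN fW by (intro add_mono card_image_le order.refl)
  finally have le: "card (E \<inter> Pow C) \<le> d + card (E \<inter> Pow N) + r" .
  have "N \<inter> W = {}" "v \<notin> N \<union> W"
    using W vN by auto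
  then have cC: "card C = Suc (d + r)"
    unfolding C d_def r_def using fN fW by (simp add: card_Un_disjoint)
  have "E \<inter> Pow N \<subseteq> nsets N 2"
    using E by (auto simp: nsets_def)
  from handshake[OF fN this]
  have hs: "2 * card (E \<inter> Pow N) = (\<Sum>u\<in>N. card {w\<in>N. {u, w} \<in> E})"
    by (auto intro!: sum.cong arg_cong[of _ _ card])
  have "2 * d + 2 * card (E \<inter> Pow N) + 2 * r \<le> (n - 2) * (d + r)"
  proof (cases "d = n - 2")
    case False
    \<comment> \<open>As \<open>d > n - 2\<close>, no path \<open>v\<close>, \<open>w\<close>,
      \<open>u\<close>, \<open>w'\<close> with \<open>w\<close> and \<open>w'\<close> distinct can
      exist, so the edges inside \<open>N\<close> form a matching.\<close>
    have "card {w\<in>N. {u, w} \<in> E} \<le> 1" if u: "u \<in> N" for u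
    proof -
      have "w = w'" if "w \<in> N" "{u, w} \<in> E" "w' \<in> N" "{u, w'} \<in> E" for w w'
        using path[of w u w'] that False u vN sym d_def by auto
      then show ?thesis
        using fN by (auto simp: card_le_Suc0_iff_eq)
    qed
    then have "2 * card (E \<inter> Pow N) \<le> d"
      using sum_bounded_above[of N "\<lambda>u. card {w\<in>N. {u, w} \<in> E}" 1] by (simp add: hs d_def)
    then have "2 * d + 2 * card (E \<inter> Pow N) + 2 * r \<le> 4 * (d + r)"
      by simp
    \<comment> \<open>Here \<open>n \<ge> 6\<close> enters as \<open>4 \<le> n - 2\<close>.\<close>
    also have "\<dots> \<le> (n - 2) * (d + r)"
      using n by (intro mult_right_mono) auto
    finally show ?thesis .
  next
    case True
    \<comment> \<open>Since \<open>d = n - 2\<close>, the set \<open>W\<close> is nonempty. A vertex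
      \<open>a\<close> carrying a leaf has no neighbour in \<open>N\<close>, so every other vertex
      of \<open>N\<close> misses both itself and \<open>a\<close>.\<close>
    then obtain w a where wa: "w \<in> W" "a \<in> N" "{a, w} \<in> E"
      using big d_def W by auto
    have "{x\<in>N. {a, x} \<in> E} = {}"
      using indep wa by auto
    then have "2 * card (E \<inter> Pow N) = (\<Sum>u\<in>N - {a}. card {w\<in>N. {u, w} \<in> E})"
      unfolding hs using fN wa by (subst sum.remove[of _ a]) (simp_all only: card.empty)
    also have "\<dots> \<le> (\<Sum>u\<in>N - {a}. d - 2)"
    proof (rule sum_mono)
      fix u assume u: "u \<in> N - {a}"
      have "{w\<in>N. {u, w} \<in> E} \<subseteq> N - {u, a}"
        using edge[of u u] sym[of u a] indep[OF wa(2,1,3)] u by auto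
      then have "card {w\<in>N. {u, w} \<in> E} \<le> card (N - {u, a})"
        using fN by (intro card_mono) auto
      also have "\<dots> = d - 2"
        using u wa fN by (subst card_Diff_subset) (auto simp: d_def)
      finally show "card {w\<in>N. {u, w} \<in> E} \<le> d - 2" .
    qed
    also have "\<dots> = (d - 1) * (d - 2)"
      using wa fN by (simp add: d_def)
    finally have in_N: "2 * card (E \<inter> Pow N) \<le> (d - 1) * (d - 2)" .
    have "4 \<le> d"
      using True n by simp
    then obtain j where j: "d = 4 + j"
      using le_Suc_ex by blast
    have "2 * d + 2 * card (E \<inter> Pow N) + 2 * r \<le> 2 * d + (d - 1) * (d - 2) + 2 * r"
      using in_N by simp
    \<comment> \<open>This amounts to \<open>2 * (r + 1) \<le> d * (r + 1)\<close>; writing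
      \<open>d = 4 + j\<close> removes the truncated subtractions.\<close>
    also have "\<dots> \<le> d * (d + r)"
      by (simp add: j algebra_simps)
    finally show ?thesis
      using True by simp
  qed
  moreover have "(n - 2) * card C = (n - 2) * (d + r) + (n - 2)"
    by (simp add: cC)
  ultimately show "2 * card (E \<inter> Pow C) + (n - 2) \<le> (n - 2) * card C"
    using le by linarith
qed

section \<open>Upper bound by removing balls\<close>

text \<open>Degrees are also below the order \<open>m\<close>. The bound \<open>n - 3\<close> alone
  gives \<open>(n - 3) * m\<close>, which suffices only for \<open>m \<ge> n - 2\<close>; smaller
  graphs need the bound \<open>m - 1\<close>.\<close>

lemma low_degree_edges:
  assumes sg: "simple_graph (V, E)" and n: "n \<ge> 3"
    and deg: "\<And>v. v \<in> V \<Longrightarrow> card {w. {v, w} \<in> E} \<le> n - 3" and "V \<noteq> {}"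
  shows "2 * card E + (n - 2) \<le> (n - 2) * card V"
proof -
  have E: "E \<subseteq> nsets V 2" and fV: "finite V"
    using sg by (auto simp: simple_graph_def edges_def verts_def)
  have edge: "x \<in> V \<and> y \<in> V \<and> x \<noteq> y" if "{x, y} \<in> E" for x y
    using that E by (auto simp: nsets_def card_2_iff doubleton_eq_iff)
  define m where "m = card V"
  have m: "m \<ge> 1"
    using fV \<open>V \<noteq> {}\<close> by (simp add: m_def Suc_le_eq card_gt_0_iff)
  have deg_m: "card {w\<in>V. {u, w} \<in> E} \<le> m - 1" if u: "u \<in> V" for u
  proof -
    have "{w\<in>V. {u, w} \<in> E} \<subseteq> V - {u}"
      using edge by auto
    then have "card {w\<in>V. {u, w} \<in> E} \<le> card (V - {u})"
      using fV by (intro card_mono) auto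
    then show ?thesis
      using u by (simp add: m_def)
  qed
  have deg_n: "card {w\<in>V. {u, w} \<in> E} \<le> n - 3" if "u \<in> V" for u
    using deg[OF that] edge by (metis (no_types, lifting) Collect_cong)
  have "2 * card E \<le> (\<Sum>u\<in>V. min (m - 1) (n - 3))"
    unfolding handshake[OF fV E] using deg_m deg_n by (intro sum_mono) auto
  then have le: "2 * card E \<le> m * min (m - 1) (n - 3)"
    by (simp add: m_def)
  obtain i where i: "m = Suc i"
    using m by (cases m) auto
  obtain j where j: "n = j + 3"
    using n by (metis add.commute le_Suc_ex)
  \<comment> \<open>With \<open>m = i + 1\<close> and \<open>n = j + 3\<close> the claim is
    \<open>(i + 1) * min i j \<le> (j + 1) * i\<close>.\<close>
  have "m * min (m - 1) (n - 3) + (n - 2) \<le> (n - 2) * m"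
  proof (cases "i \<le> j")
    case True
    then have "i * i \<le> j * i"
      by simp
    then show ?thesis
      using True by (simp add: i j min_def)
  qed (simp add: i j min_def)
  then show ?thesis
    using le by (simp add: m_def)
qed

text \<open>Induction on the order, removing one ball at a time. Both bounds are carried together: a
  ball may already save \<open>n - 2\<close> while the rest has order divisible by
  \<open>n - 1\<close>, and then only the weak bound is available for the rest.\<close>

lemma T_star_free_edges:
  assumes "simple_graph (V, E)" "\<not> contains_subgraph (V, E) (T_star n)" "n \<ge> 6"
  shows "2 * card E \<le> (n - 2) * card V \<and>
    (\<not> (n - 1) dvd card V \<longrightarrow> 2 * card E + (n - 2) \<le> (n - 2) * card V)"
  using assms
proof (induction "card V" arbitrary: V E rule: less_induct)
  case less
  note sg = less.prems(1) and free = less.prems(2) and n = \<open>n \<ge> 6\<close>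
  have E: "E \<subseteq> nsets V 2" and fV: "finite V"
    using sg by (auto simp: simple_graph_def edges_def verts_def)
  have edge: "x \<in> V \<and> y \<in> V \<and> x \<noteq> y" if "{x, y} \<in> E" for x y
    using that E by (auto simp: nsets_def card_2_iff doubleton_eq_iff)
  have fE: "finite E"
    using E fV finite_imp_finite_nsets finite_subset by blast
  show ?case
  proof (cases "\<exists>v\<in>V. card {w. {v, w} \<in> E} \<ge> n - 2")
    case False
    then have "card {w. {v, w} \<in> E} \<le> n - 3" if "v \<in> V" for v
      using that by fastforce
    then have "V \<noteq> {} \<Longrightarrow> 2 * card E + (n - 2) \<le> (n - 2) * card V"
      using low_degree_edges[OF sg] n by simp
    moreover have "V = {} \<Longrightarrow> E = {}"
      using E by (auto simp: nsets_def)
    ultimately show ?thesis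
      by (cases "V = {}") auto
  next
    case True
    then obtain v where v: "v \<in> V" and d: "card {w. {v, w} \<in> E} \<ge> n - 2"
      by blast
    define N where "N = {w. {v, w} \<in> E}"
    define W where "W = {w. \<exists>u\<in>N. {u, w} \<in> E} - insert v N"
    define C where "C = insert v (N \<union> W)"
    define E' where "E' = E \<inter> Pow (V - C)"
    note ball = ball_edges[OF sg free n N_def d[folded N_def] W_def C_def]
    have CV: "C \<subseteq> V"
      using v edge by (auto simp: C_def W_def N_def)
    have fC: "finite C"
      using CV fV finite_subset by blast
    have cV: "card V = card C + card (V - C)"
      using CV fC fV by (simp add: card_Diff_subset card_mono)
    have vC: "v \<in> C"
      by (simp add: C_def)
    have "E = (E \<inter> Pow C) \<union> E'"
      using ball(1) E unfolding E'_def by (auto simp: nsets_def)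
    \<comment> \<open>The two power sets share the empty set, which is not an edge.\<close>
    moreover have "(E \<inter> Pow C) \<inter> E' = {}"
    proof -
      have "{} \<notin> E"
        using E by (auto simp: nsets_def)
      moreover have "(E \<inter> Pow C) \<inter> E' \<subseteq> E \<inter> {{}}"
        by (auto simp: E'_def)
      ultimately show ?thesis
        by auto
    qed
    ultimately have cE: "card E = card (E \<inter> Pow C) + card E'"
      using fE by (metis card_Un_disjoint finite_Un)
    have "simple_graph (V - C, E')"
      using fV E by (auto simp: E'_def simple_graph_def verts_def edges_def nsets_def)
    moreover have "\<not> contains_subgraph (V - C, E') (T_star n)"
      using free unfolding contains_subgraph_def E'_def verts_def edges_def by fastforce
    moreover have "card (V - C) < card V"
      using v vC fV by (intro psubset_card_mono) auto
    ultimately have IH: "2 * card E' \<le> (n - 2) * card (V - C) \<and> (\<not> (n - 1) dvd card (V - C) \<longrightarrow>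
        2 * card E' + (n - 2) \<le> (n - 2) * card (V - C))"
      using less.hyps n by blast
    show ?thesis
    proof (cases "card N \<noteq> n - 2 \<or> W \<noteq> {}")
      case True
      \<comment> \<open>The saving of \<open>n - 2\<close> in \<open>C\<close> and the weak bound
        for the rest add up to the strong bound.\<close>
      then show ?thesis
        using ball(2)[OF True] IH cE cV by (simp add: algebra_simps)
    next
      case False
      have "v \<notin> N"
        using edge[of v v] by (auto simp: N_def)
      moreover have "finite N"
        using fC by (simp add: C_def)
      ultimately have cC: "card C = n - 1"
        using False n by (simp add: C_def)
      have "E \<inter> Pow C \<subseteq> nsets C 2"
        using E by (auto simp: nsets_def)
      then have "card (E \<inter> Pow C) \<le> card (nsets C 2)"
        using fC by (intro card_mono finite_imp_finite_nsets)
      then have "card (E \<inter> Pow C) \<le> (n - 1) choose 2"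
        by (simp add: card_nsets cC)
      then have "2 * card (E \<inter> Pow C) \<le> (n - 2) * card C"
        using double_choose_two[of "n - 1"] cC by (simp add: mult.commute numeral_2_eq_2)
      \<comment> \<open>A ball of \<open>n - 1\<close> vertices need not save anything, but its
        removal preserves divisibility, so any saving is inherited from the rest.\<close>
      moreover have "(n - 1) dvd card V \<longleftrightarrow> (n - 1) dvd card (V - C)"
        by (simp add: cV cC)
      ultimately show ?thesis
        using IH cE cV by (auto simp: algebra_simps)
    qed
  qed
qed

section \<open>Disjoint cliques on \<open>n - 1\<close> vertices\<close>

definition block :: "nat \<Rightarrow> nat \<Rightarrow> nat set" where
  "block m i = {i * m..<Suc i * m}"

text \<open>Blocks are the fibres of \<open>div m\<close>: disjointness and lying in a common clique
  become statements about quotients.\<close>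

lemma mem_block_iff: "m > 0 \<Longrightarrow> x \<in> block m i \<longleftrightarrow> x div m = i"
  using dividend_less_div_times[of m x] div_times_less_eq_dividend[of x m]
  by (auto simp: block_def mult.commute intro: div_nat_eqI)

lemma card_disjoint_cliques:
  assumes "m > 0"
  shows "card (\<Union>i<k. nsets (block m i) 2) = k * (m choose 2)"
proof -
  have "block m i \<inter> block m j = {}" if "i \<noteq> j" for i j
    using that assms by (auto simp: mem_block_iff)
  moreover have "nsets A 2 \<inter> nsets B 2 \<subseteq> nsets (A \<inter> B) 2" for A B :: "nat set"
    by (auto simp: nsets_def)
  moreover have "nsets {} 2 = ({} :: nat set set)"
    by (auto simp: nsets_def)
  ultimately have disj: "nsets (block m i) 2 \<inter> nsets (block m j) 2 = {}" if "i \<noteq> j" for i j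
    using that by (metis subset_empty)
  have fin: "finite (block m i)" and card: "card (block m i) = m" for i
    by (simp_all add: block_def)
  have "card (\<Union>i<k. nsets (block m i) 2) = (\<Sum>i<k. card (nsets (block m i) 2))"
    using disj fin by (intro card_UN_disjoint) (simp_all add: finite_imp_finite_nsets)
  then show ?thesis
    by (simp add: card_nsets card)
qed

text \<open>The tree is connected and an edge preserves the quotient by \<open>n - 1\<close>, so a
  copy would put \<open>n\<close> vertices into one block of size \<open>n - 1\<close>.\<close>

lemma disjoint_cliques_T_star_free:
  assumes n: "n \<ge> 4"
  shows "\<not> contains_subgraph (V, \<Union>i<k. nsets (block (n - 1) i) 2) (T_star n)"
proof
  have verts_T_star: "verts (T_star n) = {0..n - 1}" and edges_Pair: "edges (A, B) = B"
    for A :: "nat set" and B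
    by (simp_all add: verts_def edges_def T_star_def)
  assume "contains_subgraph (V, \<Union>i<k. nsets (block (n - 1) i) 2) (T_star n)"
  then obtain f where inj: "inj_on f {0..n - 1}"
    and fe: "\<forall>e\<in>edges (T_star n). f ` e \<in> (\<Union>i<k. nsets (block (n - 1) i) 2)"
    unfolding contains_subgraph_def by (auto simp: verts_T_star edges_Pair)
  have same: "f x div (n - 1) = f y div (n - 1)" if "{x, y} \<in> edges (T_star n)" for x y
    using bspec[OF fe that] n by (auto simp: nsets_def mem_block_iff)
  have "f i \<in> block (n - 1) (f 0 div (n - 1))" if i: "i \<le> n - 1" for i
  proof -
    have star: "f 0 div (n - 1) = f j div (n - 1)" if "1 \<le> j" "j \<le> n - 3" for j
      using that by (intro same) (auto simp: T_star_def edges_def)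
    have "f (n - 3) div (n - 1) = f (n - 2) div (n - 1)"
      "f (n - 2) div (n - 1) = f (n - 1) div (n - 1)"
      by (intro same; auto simp: T_star_def edges_def)+
    moreover have "i = 0 \<or> (1 \<le> i \<and> i \<le> n - 3) \<or> i = n - 2 \<or> i = n - 1"
      using i n by auto
    ultimately show ?thesis
      using star[of i] star[of "n - 3"] n by (auto simp: mem_block_iff)
  qed
  then have "f ` {0..n - 1} \<subseteq> block (n - 1) (f 0 div (n - 1))"
    by auto
  then have "card {0..n - 1} \<le> card (block (n - 1) (f 0 div (n - 1)))"
    by (rule card_inj_on_le[OF inj]) (simp add: block_def)
  then show False
    by (simp add: block_def)
qed

section \<open>The extremal number for orders congruent to 1 modulo \<open>n - 1\<close>\<close>

theorem theorem4p2:
  fixes p n k :: nat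
  assumes "p \<ge> n" and "n \<ge> 6" and "k \<ge> 1" and "p = k * (n - 1) + 1"
  shows "real (ex_number p (T_star n)) = (real n - 2) * (real p - 1) / 2"
proof -
  let ?b = "k * ((n - 1) choose 2)"
  have b: "2 * ?b = (n - 2) * (p - 1)"
  proof -
    have "2 * ?b = k * (2 * ((n - 1) choose 2))"
      by simp
    also have "\<dots> = k * ((n - 1) * (n - 2))"
      unfolding double_choose_two by (simp add: numeral_2_eq_2)
    finally show ?thesis
      using assms by simp
  qed
  have upper: "card (edges G) \<le> ?b"
    if G: "simple_graph G" "card (verts G) = p" "\<not> contains_subgraph G (T_star n)" for G :: "nat graph"
  proof -
    have GVE: "G = (verts G, edges G)"
      by (simp add: verts_def edges_def)
    \<comment> \<open>The remainder of \<open>p\<close> is 1 and \<open>n - 1 > 1\<close>, so the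
      strong bound applies.\<close>
    have "\<not> (n - 1) dvd p"
      using assms dvd_add_right_iff[of "n - 1" "k * (n - 1)" 1] by (simp del: One_nat_def)
    then have "2 * card (edges G) + (n - 2) \<le> (n - 2) * p"
      using T_star_free_edges[of "verts G" "edges G" n] G GVE assms by simp
    also have "\<dots> = 2 * ?b + (n - 2)"
      unfolding b using assms by (simp add: algebra_simps)
    finally show ?thesis
      by simp
  qed
  \<comment> \<open>The blocks cover \<open>{..<p - 1}\<close>, so the last vertex
    \<open>p - 1\<close> is isolated.\<close>
  let ?H = "({..<p}, \<Union>i<k. nsets (block (n - 1) i) 2)"
  have "block (n - 1) i \<subseteq> {..<p}" if "i < k" for i
  proof -
    have "Suc i * (n - 1) \<le> k * (n - 1)"
      using that by (intro mult_right_mono) auto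
    then show ?thesis
      using assms by (auto simp: block_def)
  qed
  then have "simple_graph ?H"
    unfolding simple_graph_def verts_def edges_def nsets_def by fastforce
  moreover have "\<not> contains_subgraph ?H (T_star n)"
    using assms by (intro disjoint_cliques_T_star_free) simp
  moreover have "card (verts ?H) = p" "card (edges ?H) = ?b"
    using card_disjoint_cliques[of "n - 1" k] assms by (simp_all add: verts_def edges_def)
  ultimately have attained: "\<exists>G :: nat graph. ?b = card (edges G) \<and>
      simple_graph G \<and> card (verts G) = p \<and> \<not> contains_subgraph G (T_star n)"
    by (intro exI[of _ ?H] conjI) simp_all
  define A where "A = {card (edges G) | G :: nat graph.
      simple_graph G \<and> card (verts G) = p \<and> \<not> contains_subgraph G (T_star n)}"
  have "?b \<in> A"
    unfolding A_def mem_Collect_eq by (rule attained)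
  moreover have bound: "A \<subseteq> {..?b}"
    unfolding A_def using upper by auto
  \<comment> \<open>Finiteness makes \<open>Max\<close> meaningful; the attained upper bound then is
    the maximum.\<close>
  moreover have "finite A"
    using bound by (rule finite_subset) simp
  ultimately have "ex_number p (T_star n) = ?b"
    unfolding ex_number_def A_def[symmetric] by (intro Max_eqI) auto
  then have "2 * ex_number p (T_star n) = (n - 2) * (p - 1)"
    using b by simp
  then have "2 * real (ex_number p (T_star n)) = real (n - 2) * real (p - 1)"
    by (metis of_nat_mult of_nat_numeral)
  then show ?thesis
    using assms by (simp add: of_nat_diff)
qed

end
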